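(* Let $K\subset\mathbb{R}^n$ be a proper convex cone and let $f\in\mathbb{R}[x_1,\dots,x_n]$ be a strictly $K$-Lorentzian form of degree $d\ge5$. Suppose that $$\bigl(D_v^kf(x)\bigr)^2>\frac{\sqrt{\alpha}\,k}{k+1}\,D_v^{k-1}f(x)\,D_v^{k+1}f(x)\qquad\text{for all }1\le k\le d-1\text{ and all }x,v\in\operatorname{int}K,$$ where $\alpha$ is the unique positive root of the cubic $t^3-t^2-2t-1=0$ (so $\alpha\approx2.1479$). Then $f$ is Hurwitz-stable over $K$.
   Context: A proper convex cone $K\subset\mathbb{R}^n$ is a nonempty convex set with $cK\subseteq K$ for all $c\ge0$ that is closed, pointed ($K\cap(-K)=\{0\}$) and has nonempty interior $\operatorname{int}K$. For $a\in\mathbb{R}^n$, $D_af=\sum_i a_i\,\partial f/\partial x_i$, and $D_v^k$ is the $k$-fold iterate of $D_v$. A polynomial $f$ is strictly log-concave at a point $a$ if $f(a)>0$ and the Hessian of $\log f$ at $a$ is negative definite; by convention the zero polynomial is not strictly log-concave at any point. A polynomial $f$ of degree $d$ is strictly $K$-CLC (strictly $K$-completely log-concave) if for any choice of $a_1,\dots,a_m\in K$ with $m\le d$, the polynomial $D_{a_1}\cdots D_{a_m}f$ is strictly log-concave at all points of $K$. A strictly $K$-Lorentzian form is a homogeneous strictly $K$-CLC polynomial. A univariate polynomial is Hurwitz-stable if all its complex roots have negative real part. A polynomial $f$ is Hurwitz-stable over $K$ if either $f\equiv0$ or for every $x,v\in\operatorname{int}K$ the univariate polynomial $t\mapsto f(x+tv)$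 is Hurwitz-stable. *)

theory Defs
  imports
    "HOL-Analysis.Analysis"
    "HOL-Computational_Algebra.Polynomial"
    "HOL-Library.Poly_Mapping"
begin

text \<open>
  A real polynomial in variables indexed by the finite type \<open>'n\<close> is a finitely supported map from
  exponent vectors \<open>'n \<Rightarrow>\<^sub>0 nat\<close> to coefficients; ring operations are those of \<^theory>\<open>HOL-Library.Poly_Mapping\<close>.
\<close>

type_synonym 'n rpoly = "('n \<Rightarrow>\<^sub>0 nat) \<Rightarrow>\<^sub>0 real"

definition mon_degree :: "('n::finite \<Rightarrow>\<^sub>0 nat) \<Rightarrow> nat"
  where "mon_degree m = (\<Sum>i\<in>UNIV. Poly_Mapping.lookup m i)"

(* total degree; 0 for the zero polynomial *)
definition total_degree :: "'n::finite rpoly \<Rightarrow> nat"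
  where "total_degree f = Max (insert 0 (mon_degree ` Poly_Mapping.keys f))"

definition homogeneous :: "'n::finite rpoly \<Rightarrow> bool"
  where "homogeneous f \<longleftrightarrow> (\<forall>m\<in>Poly_Mapping.keys f. mon_degree m = total_degree f)"

definition eval :: "'n::finite rpoly \<Rightarrow> real^'n \<Rightarrow> real"
  where "eval f x =
    (\<Sum>m\<in>Poly_Mapping.keys f. Poly_Mapping.lookup f m * (\<Prod>i\<in>UNIV. (x $ i) ^ Poly_Mapping.lookup m i))"

(* For an exponent vector m not involving i the subtraction truncates, but the coefficient is 0. *)
definition pdiff :: "'n \<Rightarrow> 'n::finite rpoly \<Rightarrow> 'n rpoly"
  where "pdiff i f =
    (\<Sum>m\<in>Poly_Mapping.keys f.
       Poly_Mapping.single (m - Poly_Mapping.single i 1)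
         (Poly_Mapping.lookup f m * real (Poly_Mapping.lookup m i)))"

(* D_a f; the factor single 0 (a $ i) is the constant polynomial a_i *)
definition dir_diff :: "real^'n \<Rightarrow> 'n::finite rpoly \<Rightarrow> 'n rpoly"
  where "dir_diff a f = (\<Sum>i\<in>UNIV. Poly_Mapping.single 0 (a $ i) * pdiff i f)"

(* the univariate polynomial t \<mapsto> f(x + t v) *)
definition line_poly :: "'n::finite rpoly \<Rightarrow> real^'n \<Rightarrow> real^'n \<Rightarrow> real poly"
  where "line_poly f x v =
    (\<Sum>m\<in>Poly_Mapping.keys f.
       smult (Poly_Mapping.lookup f m) (\<Prod>i\<in>UNIV. [:x $ i, v $ i:] ^ Poly_Mapping.lookup m i))"

definition proper_convex_cone :: "(real^'n) set \<Rightarrow> bool"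
  where "proper_convex_cone K \<longleftrightarrow>
    convex_cone K \<and> closed K \<and> K \<inter> uminus ` K = {0} \<and> interior K \<noteq> {}"

definition partial_deriv :: "'n \<Rightarrow> (real^'n \<Rightarrow> real) \<Rightarrow> real^'n \<Rightarrow> real"
  where "partial_deriv i g x = deriv (\<lambda>t. g (x + t *\<^sub>R axis i 1)) 0"

definition hessian :: "(real^'n \<Rightarrow> real) \<Rightarrow> real^'n \<Rightarrow> real^'n^'n"
  where "hessian g x = (\<chi> i j. partial_deriv i (partial_deriv j g) x)"

definition negative_definite :: "real^'n^'n \<Rightarrow> bool"
  where "negative_definite A \<longleftrightarrow> transpose A = A \<and> (\<forall>y. y \<noteq> 0 \<longrightarrow> y \<bullet> (A *v y) < 0)"

definition strictly_log_concave_at :: "'n::finite rpoly \<Rightarrow> real^'n \<Rightarrow> bool"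
  where "strictly_log_concave_at f a \<longleftrightarrow>
    eval f a > 0 \<and> negative_definite (hessian (\<lambda>x. ln (eval f x)) a)"

text \<open>
  The usual wording asks for strict log-concavity of \<open>D\<^bsub>a\<^sub>1\<^esub> \<dots> D\<^bsub>a\<^sub>m\<^esub> f\<close> at all points of \<open>K\<close>, for all
  \<open>a\<^sub>1, \<dots>, a\<^sub>m \<in> K\<close> and \<open>m \<le> d\<close>.  Read to the letter no form satisfies it: \<open>0 \<in> K\<close>, a form of positive
  degree vanishes at \<open>0\<close>, \<open>D\<^sub>0 f = 0\<close>, and the Hessian of the logarithm has rank at most \<open>1\<close> for a
  linear form (\<open>m = d - 1\<close>; so it is not definite in dimension \<open>\<ge> 2\<close>) and is \<open>0\<close> for a constant (\<open>m = d\<close>).  Here we range over nonzero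
  directions, nonzero points and \<open>m \<le> d - 2\<close>.  Every instance required here is also required by
  the literal wording, so this condition is implied by it.
\<close>

definition strictly_CLC :: "(real^'n) set \<Rightarrow> 'n::finite rpoly \<Rightarrow> bool"
  where "strictly_CLC K f \<longleftrightarrow>
    (\<forall>as. set as \<subseteq> K - {0} \<and> length as + 2 \<le> total_degree f \<longrightarrow>
       (\<forall>x\<in>K - {0}. strictly_log_concave_at (foldr dir_diff as f) x))"

definition strictly_Lorentzian :: "(real^'n) set \<Rightarrow> 'n::finite rpoly \<Rightarrow> bool"
  where "strictly_Lorentzian K f \<longleftrightarrow> homogeneous f \<and> strictly_CLC K f"

definition hurwitz_stable :: "real poly \<Rightarrow> bool"
  where "hurwitz_stable p \<longleftrightarrow> (\<forall>z::complex. poly (map_poly of_real p) z = 0 \<longrightarrow> Re z < 0)"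

definition hurwitz_stable_over :: "(real^'n) set \<Rightarrow> 'n::finite rpoly \<Rightarrow> bool"
  where "hurwitz_stable_over K f \<longleftrightarrow>
    f = 0 \<or> (\<forall>x\<in>interior K. \<forall>v\<in>interior K. hurwitz_stable (line_poly f x v))"

definition alpha :: real
  where "alpha = (THE t. 0 < t \<and> t ^ 3 - t ^ 2 - 2 * t - 1 = 0)"

end

theory Submission
  imports Defs
begin

text \<open>
  Fix \<open>x, v\<close> in the interior of \<open>K\<close> and write \<open>p(t) = f(x + t v) = \<Sum>\<^sub>k c\<^sub>k t\<^sup>k\<close>, so that
  \<open>k! c\<^sub>k = D\<^sub>v\<^sup>k f(x)\<close>.  The factor \<open>k / (k + 1)\<close> in the hypothesis is exactly what the factorials
  contribute, and the hypothesis becomes \<open>c\<^sub>k\<^sup>2 > \<beta> c\<^bsub>k-1\<^esub> c\<^bsub>k+1\<^esub>\<close> with \<open>\<beta> = \<surd>\<alpha>\<close>.  The equation of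
  \<open>\<alpha>\<close> reads \<open>\<alpha>\<^sup>3 = (\<alpha> + 1)\<^sup>2\<close>, that is \<open>\<beta>\<^sup>3 = \<beta>\<^sup>2 + 1\<close>, or \<open>1/\<beta> + 1/\<beta>\<^sup>3 = 1\<close>
  (\<open>sqrt_alpha\<close>).  All \<open>c\<^sub>k\<close> are positive: for \<open>k \<le> d - 2\<close> by complete log-concavity, and for
  \<open>k = d - 1, d\<close> because swapping \<open>x\<close> and \<open>v\<close> reverses the coefficients of a form
  (\<open>coeff_line_poly_swap\<close>).

  What remains is a statement on univariate polynomials
  (\<open>hurwitz_stable_if_strongly_log_concave\<close>), proved by exhibiting the dominant term at each
  point of the closed right half-plane.  Let \<open>z = r e\<^sup>i\<^sup>t\<close> with \<open>cos t \<ge> 0\<close>, \<open>r > 0\<close>, let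
  \<open>a\<^sub>k = c\<^sub>k r\<^sup>k\<close>, and let \<open>a\<^sub>m\<close> be the largest of these numbers.  Put \<open>x\<^sub>k = a\<^bsub>m+k\<^esub>/a\<^sub>m\<close>
  and \<open>y\<^sub>k = a\<^bsub>m-k\<^esub>/a\<^sub>m\<close>.  Then \<open>p(z) e\<^bsup>-imt\<^esup>/a\<^sub>m\<close> has real part
  \<open>1 + \<Sum>\<^sub>k\<^sub>\<ge>\<^sub>1 x\<^sub>k cos(kt) + \<Sum>\<^sub>k\<^sub>\<ge>\<^sub>1 y\<^sub>k cos(kt)\<close>.  The sequences \<open>x\<close> and \<open>y\<close> decay so fast that in each
  sum only the term \<open>k = 2\<close> matters, and the sums are at least \<open>-x\<^sub>2\<close> and \<open>-y\<^sub>2\<close>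
  (\<open>cos_sum_ge\<close>); the value \<open>t = \<pi>/2\<close> is the critical one.  Log-concavity bounds
  \<open>x\<^sub>2 + y\<^sub>2\<close> by \<open>(x\<^sub>1\<^sup>2 + y\<^sub>1\<^sup>2)/\<beta>\<close>.  Since \<open>x\<^sub>1, y\<^sub>1 \<le> 1\<close> and \<open>x\<^sub>1 y\<^sub>1 < 1/\<beta>\<close>, this is less
  than \<open>(1 + 1/\<beta>\<^sup>2)/\<beta> = 1\<close>, so the real part is positive and \<open>p(z) \<noteq> 0\<close>.
\<close>

section \<open>Cosine sums with rapidly decaying coefficients\<close>

lemma abs_cos_odd_multiple_le:
  fixes t :: real
  assumes "odd k"
  shows "\<bar>cos (real k * t)\<bar> \<le> real k * \<bar>cos t\<bar>"
proof -
  have "\<bar>cos (real (2 * j + 1) * t)\<bar> \<le> real (2 * j + 1) * \<bar>cos t\<bar>" for j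
  proof (induction j)
    case 0
    then show ?case by simp
  next
    case (Suc j)
    let ?a = "real (2 * j + 1) * t"
    have "cos (real (2 * Suc j + 1) * t) = cos (?a + 2 * t)"
      by (rule arg_cong[of _ _ cos]) (simp add: algebra_simps)
    also have "\<dots> = cos ?a * cos (2 * t) - sin ?a * (2 * sin t * cos t)"
      by (simp only: cos_add sin_double)
    finally have "\<bar>cos (real (2 * Suc j + 1) * t)\<bar>
        \<le> \<bar>cos ?a\<bar> * \<bar>cos (2 * t)\<bar> + \<bar>sin ?a\<bar> * (2 * \<bar>sin t\<bar> * \<bar>cos t\<bar>)"
      using abs_triangle_ineq4[of "cos ?a * cos (2 * t)" "sin ?a * (2 * sin t * cos t)"]
      by (simp add: abs_mult)
    also have "\<dots> \<le> \<bar>cos ?a\<bar> * 1 + 1 * (2 * 1 * \<bar>cos t\<bar>)"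
      by (intro add_mono mult_mono) auto
    also have "\<dots> \<le> real (2 * Suc j + 1) * \<bar>cos t\<bar>"
      using Suc by (simp add: algebra_simps)
    finally show ?case .
  qed
  with assms show ?thesis by (auto elim!: oddE)
qed

lemma cos_multiples_four_five:
  fixes t :: real
  shows "cos (4 * t) = 8 * cos t ^ 4 - 8 * cos t ^ 2 + 1"
    and "cos (5 * t) = 16 * cos t ^ 5 - 20 * cos t ^ 3 + 5 * cos t"
proof -
  have "cos (4 * t) = cos (2 * (2 * t))" by simp
  also have "\<dots> = 2 * (2 * cos t ^ 2 - 1) ^ 2 - 1" by (simp only: cos_double_cos)
  finally show 4: "cos (4 * t) = 8 * cos t ^ 4 - 8 * cos t ^ 2 + 1"
    by (simp add: power2_eq_square power4_eq_xxxx algebra_simps)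
  have "cos (5 * t) + cos (3 * t) = cos (4 * t + t) + cos (4 * t - t)"
    by simp
  also have "\<dots> = 2 * cos (4 * t) * cos t"
    unfolding cos_add cos_diff by simp
  finally show "cos (5 * t) = 16 * cos t ^ 5 - 20 * cos t ^ 3 + 5 * cos t"
    unfolding 4 cos_treble_cos by (simp add: eval_nat_numeral algebra_simps)
qed

text \<open>
  By log-concavity each ratio \<open>x\<^bsub>k+1\<^esub>/x\<^sub>k\<close> is smaller than the previous one by a factor \<open>b\<close>, and the
  first ratio is at most \<open>1\<close>.  The support condition excludes internal zeros, across which the
  ratios would carry no information.
\<close>
lemma log_concave_ratio_decay:
  fixes x :: "nat \<Rightarrow> real"
  assumes "b \<ge> 0"
    and nonneg: "\<And>k. x k \<ge> 0"
    and logc: "\<And>k. b * x k * x (k + 2) \<le> (x (k + 1))\<^sup>2"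
    and supp: "\<And>k. x k = 0 \<Longrightarrow> x (k + 1) = 0"
    and first: "x 1 \<le> x 0"
  shows "b ^ k * x (k + 1) \<le> x k"
proof (induction k)
  case 0
  then show ?case using first by simp
next
  case (Suc k)
  show ?case
  proof (cases "x k = 0")
    case True
    then have "x (k + 1) = 0" "x (k + 1 + 1) = 0" using supp by blast+
    then show ?thesis by simp
  next
    case False
    with nonneg[of k] have pos: "x k > 0" by linarith
    have "x k * (b ^ Suc k * x (k + 2)) = b ^ k * (b * x k * x (k + 2))" by simp
    also have "\<dots> \<le> b ^ k * (x (k + 1))\<^sup>2"
      using logc[of k] \<open>b \<ge> 0\<close> by (intro mult_left_mono) auto
    also have "\<dots> = (b ^ k * x (k + 1)) * x (k + 1)" by (simp add: power2_eq_square)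
    also have "\<dots> \<le> x k * x (k + 1)"
      using Suc nonneg[of "k + 1"] by (intro mult_right_mono) auto
    finally show ?thesis using pos by simp
  qed
qed

text \<open>
  Write \<open>s = cos t\<close> and expand \<open>cos(kt)\<close> in powers of \<open>s\<close> for \<open>k \<le> 5\<close>.  The constant terms are
  \<open>-x\<^sub>2 + x\<^sub>4\<close>.  Up to a summand \<open>5 s x\<^sub>5\<close>, those of order \<open>s\<close>, \<open>s\<^sup>2\<close>, \<open>s\<^sup>3\<close> combine to
  \<open>s (x\<^sub>1 - 3 x\<^sub>3)\<close>, \<open>2 s\<^sup>2 (x\<^sub>2 - 4 x\<^sub>4)\<close> and \<open>4 s\<^sup>3 (x\<^sub>3 - 5 x\<^sub>5)\<close>, which are nonnegative by
  the decay.  The spare amount \<open>x\<^sub>4 + 5 s x\<^sub>5\<close> pays for the tail \<open>k \<ge> 6\<close>.  The tail needs the bound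
  \<open>\<bar>cos(kt)\<bar> \<le> k s\<close> for odd \<open>k\<close>, since for small \<open>s\<close> odd terms can only be paid for by
  amounts of order \<open>s\<close>.  The sharpest requirement is \<open>3 x\<^sub>3 \<le> x\<^sub>1\<close>, that is \<open>b\<^sup>3 \<ge> 3\<close>,
  and \<open>29/20\<close> is a convenient number with this property below the constant \<open>1.4655...\<close> to
  which the lemma is applied.
\<close>
lemma cos_sum_ge:
  fixes x :: "nat \<Rightarrow> real" and b t :: real
  assumes b: "b \<ge> 29 / 20"
    and nonneg: "\<And>k. x k \<ge> 0"
    and logc: "\<And>k. b * x k * x (k + 2) \<le> (x (k + 1))\<^sup>2"
    and supp: "\<And>k. x k = 0 \<Longrightarrow> x (k + 1) = 0"
    and first: "x 1 \<le> x 0"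
    and t: "cos t \<ge> 0"
    and zero: "\<And>k. k > N \<Longrightarrow> x k = 0"
  shows "(\<Sum>k=1..N. x k * cos (real k * t)) \<ge> - x 2"
proof -
  define s where "s = cos t"
  have s: "s \<ge> 0" using t by (simp add: s_def)
  have pow: "(29 / 20) ^ k \<le> b ^ k" for k
    using b by (intro power_mono) auto
  have b3: "b ^ 3 \<ge> 3" and b5: "b ^ 5 \<ge> 4" and b7: "b ^ 7 \<ge> 5"
    using pow[of 3] pow[of 5] pow[of 7] by (simp_all add: eval_nat_numeral)
  have decay: "b ^ k * x (k + 1) \<le> x k" for k
    using log_concave_ratio_decay[of b x k] assms by auto
  have decay2: "b ^ (2 * k + 1) * x (k + 2) \<le> x k" for k
  proof -
    have "b ^ k * (b ^ (k + 1) * x (k + 1 + 1)) \<le> b ^ k * x (k + 1)"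
      using decay[of "k + 1"] b by (intro mult_left_mono) auto
    also have "\<dots> \<le> x k" by (rule decay)
    finally show ?thesis by (simp add: power_add mult_2 mult.assoc mult.left_commute)
  qed
  have shrink: "c * x (k + 2) \<le> x k" if "c \<le> b ^ (2 * k + 1)" for c k
    using mult_right_mono[OF that nonneg[of "k + 2"]] decay2[of k] by linarith
  have x3: "3 * x 3 \<le> x 1" and x4: "4 * x 4 \<le> x 2" and x5: "5 * x 5 \<le> x 3"
    using shrink[of 3 1] shrink[of 4 2] shrink[of 5 3] b3 b5 b7 by (simp_all add: numeral_eq_Suc)
  have quarter: "4 * x (k + 2) \<le> x k" if "k \<ge> 2" for k
  proof (rule shrink)
    have "b ^ 5 \<le> b ^ (2 * k + 1)" using b that by (intro power_increasing) auto
    with b5 show "4 \<le> b ^ (2 * k + 1)" by linarith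
  qed
  \<comment> \<open>\<open>g k\<close> bounds \<open>\<bar>cos(kt)\<bar>\<close>; each of the two parity classes of the majorant \<open>e\<close> is
    dominated by a geometric series of ratio \<open>1/2\<close>, so the tail is at most its two predecessors.\<close>
  define g where "g = (\<lambda>k::nat. if even k then 1 else real k * s)"
  have g_nonneg: "g k \<ge> 0" for k using s by (simp add: g_def)
  have cos_g: "- g k \<le> cos (real k * t)" for k
    using abs_cos_odd_multiple_le[of k t] s by (auto simp: g_def s_def abs_le_iff)
  define e where "e = (\<lambda>k. g k * x k)"
  have e_nonneg: "e k \<ge> 0" for k using g_nonneg nonneg by (simp add: e_def)
  have e_half: "2 * e (k + 2) \<le> e k" if "k \<ge> 2" for k
  proof -
    have "real (k + 2) * s \<le> (2 * real k) * s" using s that by (intro mult_right_mono) auto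
    then have "g (k + 2) \<le> 2 * g k" by (simp add: g_def)
    then have "2 * e (k + 2) \<le> 2 * ((2 * g k) * x (k + 2))"
      unfolding e_def using nonneg by (intro mult_left_mono mult_right_mono) auto
    also have "\<dots> = g k * (4 * x (k + 2))" by simp
    also have "\<dots> \<le> e k"
      unfolding e_def using quarter[OF that] g_nonneg by (intro mult_left_mono) auto
    finally show ?thesis .
  qed
  have tail: "(\<Sum>k=6..M + 5. e k) + e (M + 5) + e (M + 4) \<le> e 4 + e 5" for M
  proof (induction M)
    case 0
    then show ?case by simp
  next
    case (Suc M)
    have "2 * e (M + 6) \<le> e (M + 4)" using e_half[of "M + 4"] by (simp add: add_ac)
    moreover have "(\<Sum>k=6..Suc (M + 5). e k) = (\<Sum>k=6..M + 5. e k) + e (Suc (M + 5))"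
      by (subst sum.cl_ivl_Suc) (rule if_not_P, simp)
    ultimately show ?case using Suc by (simp add: add_ac)
  qed
  have "(\<Sum>k=6..N + 5. x k * cos (real k * t)) \<ge> - (\<Sum>k=6..N + 5. e k)"
    unfolding sum_negf[symmetric]
  proof (rule sum_mono)
    fix k
    show "- e k \<le> x k * cos (real k * t)"
      using mult_left_mono[OF cos_g[of k] nonneg[of k]] by (simp add: e_def mult.commute)
  qed
  with tail[of N] e_nonneg[of "N + 5"] e_nonneg[of "N + 4"]
  have rest: "(\<Sum>k=6..N + 5. x k * cos (real k * t)) \<ge> - x 4 - 5 * s * x 5"
    by (simp add: e_def g_def)
  have five: "(\<Sum>k=1..5. h k) = h 1 + h 2 + h 3 + h 4 + h 5" for h :: "nat \<Rightarrow> real"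
    by (simp add: numeral_eq_Suc)
  have split: "(\<Sum>k=1..N. x k * cos (real k * t))
      = (\<Sum>k=1..5. x k * cos (real k * t)) + (\<Sum>k=6..N + 5. x k * cos (real k * t))"
  proof -
    have "(\<Sum>k=1..N. x k * cos (real k * t)) = (\<Sum>k=1..N + 5. x k * cos (real k * t))"
      using zero by (intro sum.mono_neutral_left) auto
    also have "\<dots> = (\<Sum>k=1..5. x k * cos (real k * t)) + (\<Sum>k=6..N + 5. x k * cos (real k * t))"
      using sum.ub_add_nat[of 1 5 "\<lambda>k. x k * cos (real k * t)" N] by (simp add: add.commute)
    finally show ?thesis .
  qed
  have "(\<Sum>k=1..5. x k * cos (real k * t)) = x 1 * s + x 2 * (2 * s ^ 2 - 1)
      + x 3 * (4 * s ^ 3 - 3 * s) + x 4 * (8 * s ^ 4 - 8 * s ^ 2 + 1)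
      + x 5 * (16 * s ^ 5 - 20 * s ^ 3 + 5 * s)"
    unfolding five by (simp add: s_def cos_multiples_four_five cos_treble_cos cos_double_cos)
  also have "\<dots> = - x 2 + x 4 + 5 * s * x 5 + s * (x 1 - 3 * x 3) + 2 * s ^ 2 * (x 2 - 4 * x 4)
      + 4 * s ^ 3 * (x 3 - 5 * x 5) + 8 * s ^ 4 * x 4 + 16 * s ^ 5 * x 5"
    by (simp add: algebra_simps)
  also have "\<dots> \<ge> - x 2 + x 4 + 5 * s * x 5"
  proof -
    have "0 \<le> s * (x 1 - 3 * x 3)" "0 \<le> 2 * s ^ 2 * (x 2 - 4 * x 4)"
      "0 \<le> 4 * s ^ 3 * (x 3 - 5 * x 5)" "0 \<le> 8 * s ^ 4 * x 4" "0 \<le> 16 * s ^ 5 * x 5"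
      using s x3 x4 x5 nonneg by simp_all
    then show ?thesis by linarith
  qed
  finally show ?thesis using rest split by linarith
qed

section \<open>A stability criterion for univariate polynomials\<close>

text \<open>
  At a point of the closed right half-plane, the largest term \<open>a m\<close> in absolute value outweighs the
  others after a rotation that makes it real.  The constant \<open>b\<close> is the smallest one for which
  \<open>x 1 \<le> 1\<close>, \<open>y 1 \<le> 1\<close> and \<open>b * (x 1 * y 1) < 1\<close> force \<open>(x 1)\<^sup>2 + (y 1)\<^sup>2 < b\<close>: the
  extreme case is \<open>{1, 1/b}\<close>, and \<open>1 + 1/b\<^sup>2 = b\<close> is the equation of \<open>b\<close>.
\<close>
lemma hurwitz_stable_if_strongly_log_concave:
  fixes p :: "real poly" and b :: real
  assumes b: "b > 0" "b ^ 3 = b ^ 2 + 1"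
    and pos: "\<And>k. k \<le> degree p \<Longrightarrow> coeff p k > 0"
    and logc: "\<And>k. 1 \<le> k \<Longrightarrow> k < degree p \<Longrightarrow>
      b * coeff p (k - 1) * coeff p (k + 1) < (coeff p k)\<^sup>2"
  shows "hurwitz_stable p"
  unfolding hurwitz_stable_def
proof (intro allI impI, rule ccontr)
  fix z :: complex
  assume root: "poly (map_poly of_real p) z = 0" and "\<not> Re z < 0"
  then have Re: "Re z \<ge> 0" by simp
  define n where "n = degree p"
  define r where "r = cmod z"
  define t where "t = Arg z"
  have root_sum: "(\<Sum>k\<le>n. of_real (coeff p k) * z ^ k) = 0"
    using root by (simp add: poly_altdef n_def degree_map_poly coeff_map_poly)
  have "z \<noteq> 0"
  proof
    assume "z = 0"
    with root have "coeff p 0 = 0" by (simp add: poly_0_coeff_0 coeff_map_poly)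
    with pos[of 0] show False by simp
  qed
  then have r: "r > 0" by (simp add: r_def)
  have z: "z = of_real r * cis t"
    using rcis_cmod_Arg[of z] by (simp add: r_def t_def rcis_def)
  have t: "cos t \<ge> 0" using Re r by (simp add: z zero_le_mult_iff)
  have b145: "b \<ge> 29 / 20"
  proof (rule ccontr)
    assume "\<not> b \<ge> 29 / 20"
    then have "b < 29 / 20" by simp
    then have "b ^ 2 * (b - 1) < 1"
    proof (cases "b \<le> 1")
      case True
      have "b ^ 2 * (b - 1) \<le> 0" using True by (simp add: mult_nonneg_nonpos)
      then show ?thesis by simp
    next
      case False
      with \<open>b < 29 / 20\<close> b have "b ^ 2 * (b - 1) \<le> (29 / 20) ^ 2 * (29 / 20 - 1)"
        by (intro mult_mono power_mono) auto
      also have "\<dots> < (1::real)" by (simp add: power2_eq_square)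
      finally show ?thesis .
    qed
    with b show False by (simp add: algebra_simps eval_nat_numeral)
  qed
  define a where "a = (\<lambda>k. coeff p k * r ^ k)"
  have a_pos: "a k > 0" if "k \<le> n" for k using pos[of k] that r by (simp add: a_def n_def)
  have a_zero: "a k = 0" if "k > n" for k using that by (simp add: a_def n_def coeff_eq_0)
  have a_nonneg: "a k \<ge> 0" for k using a_pos[of k] a_zero[of k] by (cases "k \<le> n") auto
  have a_logc_strict: "b * a k * a (k + 2) < (a (k + 1))\<^sup>2" if "k + 1 < n" for k
  proof -
    have "b * a k * a (k + 2) = (b * coeff p k * coeff p (k + 2)) * (r ^ (k + 1))\<^sup>2"
      by (simp add: a_def power2_eq_square)
    also have "\<dots> < (coeff p (k + 1))\<^sup>2 * (r ^ (k + 1))\<^sup>2"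
      using logc[of "k + 1"] that r by (intro mult_strict_right_mono) (auto simp: n_def)
    finally show ?thesis by (simp add: a_def power_mult_distrib)
  qed
  have a_logc: "b * a k * a (k + 2) \<le> (a (k + 1))\<^sup>2" for k
    using a_logc_strict[of k] a_zero[of "k + 2"] by (cases "k + 1 < n") auto
  obtain m where m: "m \<le> n" and max: "\<And>k. k \<le> n \<Longrightarrow> a k \<le> a m"
  proof -
    have "Max (a ` {..n}) \<in> a ` {..n}" by (intro Max_in) auto
    then obtain m where m: "m \<in> {..n}" "Max (a ` {..n}) = a m" by (rule imageE) auto
    have "a k \<le> Max (a ` {..n})" if "k \<le> n" for k using that by (intro Max_ge) auto
    with m that[of m] show thesis by simp
  qed
  have am: "a m > 0" using a_pos m by simp
  define x where "x = (\<lambda>k. a (m + k) / a m)"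
  define y where "y = (\<lambda>k. if k \<le> m then a (m - k) / a m else 0)"
  have x0: "x 0 = 1" and y0: "y 0 = 1" using am by (simp_all add: x_def y_def)
  have x1: "0 \<le> x 1" "x 1 \<le> 1"
    using max[of "m + 1"] a_zero[of "m + 1"] a_nonneg[of "m + 1"] am
    by (cases "m < n"; simp add: x_def)+
  have y1: "0 \<le> y 1" "y 1 \<le> 1"
    using max[of "m - 1"] a_nonneg[of "m - 1"] am m by (auto simp: y_def divide_simps)
  have x_logc: "b * x k * x (k + 2) \<le> (x (k + 1))\<^sup>2" for k
    using a_logc[of "m + k"] am by (simp add: x_def field_simps power2_eq_square)
  have y_logc: "b * y k * y (k + 2) \<le> (y (k + 1))\<^sup>2" for k
  proof (cases "k + 2 \<le> m")
    case True
    define j where "j = m - (k + 2)"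
    have "m - k = j + 2" "m - (k + 1) = j + 1" "m - (k + 2) = j" using True by (auto simp: j_def)
    with a_logc[of j] am True show ?thesis
      by (simp add: y_def field_simps power2_eq_square)
  qed (simp add: y_def)
  have sx: "(\<Sum>k=1..n. x k * cos (real k * t)) \<ge> - x 2"
  proof (rule cos_sum_ge[OF b145])
    show "x (k + 1) = 0" if "x k = 0" for k
      using that a_pos[of "m + k"] a_zero[of "m + (k + 1)"] am
      by (cases "m + k \<le> n") (auto simp: x_def)
  qed (use x_logc x0 x1 t a_nonneg am a_zero in \<open>auto simp: x_def\<close>)
  have sy: "(\<Sum>k=1..n. y k * cos (real k * t)) \<ge> - y 2"
  proof (rule cos_sum_ge[OF b145])
    show "y (k + 1) = 0" if "y k = 0" for k
      using that a_pos[OF le_trans[OF diff_le_self m], of k] am by (cases "k \<le> m") (auto simp: y_def)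
  qed (use y_logc y0 y1 t a_nonneg am m in \<open>auto simp: y_def\<close>)
  have xy: "b * (x 1 * y 1) < 1"
  proof (cases "1 \<le> m \<and> m < n")
    case True
    then have "b * a (m - 1) * a (m + 1) < (a m)\<^sup>2" using a_logc_strict[of "m - 1"] by simp
    with am True show ?thesis by (simp add: x_def y_def field_simps power2_eq_square)
  next
    case False
    then have "x 1 = 0 \<or> y 1 = 0" using m a_zero[of "m + 1"] by (auto simp: x_def y_def)
    then show ?thesis by auto
  qed
  have x2y2: "x 2 + y 2 < 1"
  proof -
    have sq: "(b * (x 1 * y 1))\<^sup>2 < 1"
      using xy x1 y1 b by (subst abs_square_less_1) (simp add: abs_mult)
    \<comment> \<open>With \<open>x 1, y 1 \<le> 1\<close> and a given product, the sum of squares is largest when one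
      of them is \<open>1\<close>.\<close>
    have "0 \<le> (1 - (x 1)\<^sup>2) * (1 - (y 1)\<^sup>2)"
      using x1 y1 by (intro mult_nonneg_nonneg) (auto simp: power_le_one)
    then have "(x 1)\<^sup>2 + (y 1)\<^sup>2 \<le> 1 + (x 1 * y 1)\<^sup>2"
      by (simp add: algebra_simps power_mult_distrib)
    moreover have "b * x 2 \<le> (x 1)\<^sup>2" "b * y 2 \<le> (y 1)\<^sup>2"
      using x_logc[of 0] y_logc[of 0] x0 y0 by (simp_all add: numeral_eq_Suc)
    ultimately have "b ^ 2 * (b * (x 2 + y 2)) \<le> b ^ 2 * (1 + (x 1 * y 1)\<^sup>2)"
      by (intro mult_left_mono) (simp_all add: algebra_simps)
    also have "\<dots> = b ^ 2 + (b * (x 1 * y 1))\<^sup>2" by (simp add: power_mult_distrib algebra_simps)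
    also have "\<dots> < b ^ 3" using sq b by simp
    also have "\<dots> = b ^ 2 * (b * 1)" by (simp add: eval_nat_numeral)
    finally show ?thesis using b by simp
  qed
  have "0 = Re ((\<Sum>k\<le>n. of_real (coeff p k) * z ^ k) * cis (- (real m * t)))"
    by (simp add: root_sum)
  also have "\<dots> = (\<Sum>k\<le>n. a k * cos ((real k - real m) * t))"
    unfolding sum_distrib_right Re_sum
  proof (rule sum.cong[OF refl])
    fix k
    have "z ^ k = of_real (r ^ k) * cis (real k * t)"
      by (subst z) (simp only: power_mult_distrib Complex.DeMoivre of_real_power)
    then have "of_real (coeff p k) * z ^ k * cis (- (real m * t))
        = of_real (a k) * (cis (real k * t) * cis (- (real m * t)))"
      by (simp add: a_def)
    also have "cis (real k * t) * cis (- (real m * t)) = cis ((real k - real m) * t)"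
      by (simp add: cis_mult algebra_simps)
    finally show "Re (of_real (coeff p k) * z ^ k * cis (- (real m * t)))
        = a k * cos ((real k - real m) * t)" by simp
  qed
  also have "\<dots> = a m * (1 + (\<Sum>k=1..n. x k * cos (real k * t)) + (\<Sum>k=1..n. y k * cos (real k * t)))"
  proof -
    let ?h = "\<lambda>k. a k * cos ((real k - real m) * t)"
    have flip: "cos ((real k - real m) * t) = cos (real (m - k) * t)" if "k \<le> m" for k
    proof -
      have "(real k - real m) * t = - (real (m - k) * t)"
        using that by (simp add: of_nat_diff algebra_simps)
      then show ?thesis by (simp only: cos_minus)
    qed
    have "{..n} = {..<m} \<union> ({m} \<union> {m<..n})" using m by auto
    then have "(\<Sum>k\<le>n. ?h k) = (\<Sum>k<m. ?h k) + (\<Sum>k\<in>{m} \<union> {m<..n}. ?h k)"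
      by (simp only:) (intro sum.union_disjoint; auto)
    also have "(\<Sum>k\<in>{m} \<union> {m<..n}. ?h k) = a m + (\<Sum>k\<in>{m<..n}. ?h k)"
      by (subst sum.union_disjoint) auto
    also have "(\<Sum>k<m. ?h k) = (\<Sum>k=1..m. a m * (y k * cos (real k * t)))"
      by (rule sum.reindex_bij_witness[of _ "\<lambda>k. m - k" "\<lambda>k. m - k"])
        (use am in \<open>auto simp: y_def flip\<close>)
    also have "\<dots> = (\<Sum>k=1..n. a m * (y k * cos (real k * t)))"
      using m by (intro sum.mono_neutral_left) (auto simp: y_def)
    also have "(\<Sum>k\<in>{m<..n}. ?h k) = (\<Sum>k=1..n - m. a m * (x k * cos (real k * t)))"
      by (rule sum.reindex_bij_witness[of _ "\<lambda>k. m + k" "\<lambda>k. k - m"])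
        (use am in \<open>auto simp: x_def of_nat_diff\<close>)
    also have "\<dots> = (\<Sum>k=1..n. a m * (x k * cos (real k * t)))"
      using a_zero by (intro sum.mono_neutral_left) (auto simp: x_def)
    finally show ?thesis by (simp add: sum_distrib_left distrib_left)
  qed
  finally have "1 + (\<Sum>k=1..n. x k * cos (real k * t)) + (\<Sum>k=1..n. y k * cos (real k * t)) = 0"
    using am by simp
  with sx sy x2y2 show False by linarith
qed

section \<open>Restriction of a form to a line\<close>

definition mon_line :: "real^'n \<Rightarrow> real^'n \<Rightarrow> ('n::finite \<Rightarrow>\<^sub>0 nat) \<Rightarrow> real poly"
  where "mon_line x v m = (\<Prod>i\<in>UNIV. [:x $ i, v $ i:] ^ Poly_Mapping.lookup m i)"

lemma line_poly_eq_sum_superset: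
  assumes "finite S" "Poly_Mapping.keys f \<subseteq> S"
  shows "line_poly f x v = (\<Sum>m\<in>S. smult (Poly_Mapping.lookup f m) (mon_line x v m))"
  unfolding line_poly_def mon_line_def[symmetric]
  using assms by (intro sum.mono_neutral_left) (auto simp: in_keys_iff)

lemma line_poly_zero [simp]: "line_poly 0 x v = 0"
  by (simp add: line_poly_def)

lemma line_poly_add [simp]: "line_poly (f + g) x v = line_poly f x v + line_poly g x v"
proof -
  let ?S = "Poly_Mapping.keys f \<union> Poly_Mapping.keys g"
  have "Poly_Mapping.keys (f + g) \<subseteq> ?S" by (rule keys_add)
  then have "line_poly (f + g) x v =
      (\<Sum>m\<in>?S. smult (Poly_Mapping.lookup (f + g) m) (mon_line x v m))"
    by (intro line_poly_eq_sum_superset) auto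
  also have "\<dots> = line_poly f x v + line_poly g x v"
    by (subst (1 2) line_poly_eq_sum_superset[of ?S])
      (auto simp: lookup_add smult_add_left sum.distrib)
  finally show ?thesis .
qed

lemma line_poly_sum [simp]: "line_poly (\<Sum>i\<in>S. F i) x v = (\<Sum>i\<in>S. line_poly (F i) x v)"
  by (induction S rule: infinite_finite_induct) auto

lemma line_poly_single [simp]: "line_poly (Poly_Mapping.single m c) x v = smult c (mon_line x v m)"
  by (cases "c = 0") (auto simp: line_poly_def mon_line_def)

lemma smult_sum_right: "smult c (\<Sum>i\<in>S. p i) = (\<Sum>i\<in>S. smult c (p i))"
  by (induction S rule: infinite_finite_induct) (auto simp: smult_add_right)

lemma pderiv_sum: "pderiv (\<Sum>i\<in>S. p i) = (\<Sum>i\<in>S. pderiv (p i))"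
  by (induction S rule: infinite_finite_induct) (auto simp: pderiv_add)

text \<open>
  Where an exponent is \<open>0\<close> the truncated subtraction in \<open>m - single i 1\<close> is harmless:
  the coefficient \<open>lookup m i\<close> vanishes.
\<close>
lemma pderiv_mon_line:
  "pderiv (mon_line x v m) = (\<Sum>i\<in>UNIV. smult (v $ i * real (Poly_Mapping.lookup m i))
     (mon_line x v (m - Poly_Mapping.single i 1)))"
  unfolding mon_line_def pderiv_prod
proof (rule sum.cong[OF refl])
  fix i :: 'a
  let ?l = "\<lambda>j. [:x $ j, v $ j:]"
  have rest: "(\<Prod>j\<in>UNIV - {i}. ?l j ^ Poly_Mapping.lookup m j)
     = (\<Prod>j\<in>UNIV - {i}. ?l j ^ Poly_Mapping.lookup (m - Poly_Mapping.single i 1) j)"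
    by (intro prod.cong) (auto simp: lookup_minus lookup_single)
  have "(\<Prod>j\<in>UNIV. ?l j ^ Poly_Mapping.lookup (m - Poly_Mapping.single i 1) j)
     = ?l i ^ (Poly_Mapping.lookup m i - 1) * (\<Prod>j\<in>UNIV - {i}. ?l j ^ Poly_Mapping.lookup m j)"
    unfolding rest by (subst prod.remove[of UNIV i]) (auto simp: lookup_minus)
  moreover have "pderiv (?l i ^ Poly_Mapping.lookup m i)
     = smult (v $ i * real (Poly_Mapping.lookup m i)) (?l i ^ (Poly_Mapping.lookup m i - 1))"
    by (simp add: pderiv_power pderiv_pCons mult.commute)
  ultimately show "(\<Prod>j\<in>UNIV - {i}. ?l j ^ Poly_Mapping.lookup m j) * pderiv (?l i ^ Poly_Mapping.lookup m i)
     = smult (v $ i * real (Poly_Mapping.lookup m i))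
        (\<Prod>j\<in>UNIV. ?l j ^ Poly_Mapping.lookup (m - Poly_Mapping.single i 1) j)"
    by (simp add: mult.commute)
qed

lemma pderiv_line_poly: "pderiv (line_poly f x v) = line_poly (dir_diff v f) x v"
proof -
  have "pderiv (line_poly f x v) = (\<Sum>m\<in>Poly_Mapping.keys f. \<Sum>i\<in>UNIV.
      smult (Poly_Mapping.lookup f m * (v $ i * real (Poly_Mapping.lookup m i)))
        (mon_line x v (m - Poly_Mapping.single i 1)))"
    by (simp add: line_poly_def mon_line_def[symmetric] pderiv_smult
        pderiv_mon_line smult_sum_right pderiv_sum)
  also have "\<dots> = (\<Sum>i\<in>UNIV. \<Sum>m\<in>Poly_Mapping.keys f.
      smult (Poly_Mapping.lookup f m * (v $ i * real (Poly_Mapping.lookup m i)))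
        (mon_line x v (m - Poly_Mapping.single i 1)))"
    by (rule sum.swap)
  also have "\<dots> = line_poly (dir_diff v f) x v"
    by (simp add: dir_diff_def pdiff_def sum_distrib_left mult_single mult_ac)
  finally show ?thesis .
qed

lemma poly_line_poly: "poly (line_poly f x v) t = eval f (x + t *\<^sub>R v)"
  by (simp add: line_poly_def eval_def poly_sum poly_prod)

lemma coeff_line_poly: "fact k * coeff (line_poly f x v) k = eval ((dir_diff v ^^ k) f) x"
proof -
  have "(pderiv ^^ k) (line_poly f x v) = line_poly ((dir_diff v ^^ k) f) x v"
    by (induction k) (auto simp: pderiv_line_poly)
  then have "coeff ((pderiv ^^ k) (line_poly f x v)) 0 = eval ((dir_diff v ^^ k) f) x"
    using poly_line_poly[of "(dir_diff v ^^ k) f" x v 0] by (simp add: poly_0_coeff_0)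
  then show ?thesis by (simp add: coeff_higher_pderiv pochhammer_fact)
qed

lemma eval_scaleR_homogeneous:
  assumes "homogeneous f"
  shows "eval f (c *\<^sub>R x) = c ^ total_degree f * eval f x"
proof -
  have "(\<Prod>i\<in>UNIV. (c * x $ i) ^ Poly_Mapping.lookup m i)
      = c ^ total_degree f * (\<Prod>i\<in>UNIV. (x $ i) ^ Poly_Mapping.lookup m i)"
    if "m \<in> Poly_Mapping.keys f" for m
    using assms that
    by (auto simp: homogeneous_def mon_degree_def power_mult_distrib prod.distrib power_sum[symmetric])
  then show ?thesis
    unfolding eval_def by (simp add: sum_distrib_left mult_ac)
qed

lemma degree_line_poly_le:
  assumes "homogeneous f"
  shows "degree (line_poly f x v) \<le> total_degree f"
proof -
  have "degree (mon_line x v m) \<le> total_degree f" if "m \<in> Poly_Mapping.keys f" for m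
  proof -
    have "degree (mon_line x v m)
        \<le> sum (degree \<circ> (\<lambda>i. [:x $ i, v $ i:] ^ Poly_Mapping.lookup m i)) UNIV"
      unfolding mon_line_def by (rule degree_prod_sum_le) auto
    also have "\<dots> \<le> (\<Sum>i\<in>UNIV. Poly_Mapping.lookup m i)"
    proof (rule sum_mono)
      fix i
      have "degree ([:x $ i, v $ i:] ^ Poly_Mapping.lookup m i)
          \<le> degree [:x $ i, v $ i:] * Poly_Mapping.lookup m i" by (rule degree_power_le)
      also have "\<dots> \<le> 1 * Poly_Mapping.lookup m i" by (intro mult_right_mono) auto
      finally show "(degree \<circ> (\<lambda>i. [:x $ i, v $ i:] ^ Poly_Mapping.lookup m i)) i
          \<le> Poly_Mapping.lookup m i" by simp
    qed
    also have "\<dots> = total_degree f" using that assms by (auto simp: homogeneous_def mon_degree_def)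
    finally show ?thesis .
  qed
  then show ?thesis unfolding line_poly_def mon_line_def[symmetric]
    by (intro degree_sum_le) (auto intro: order_trans[OF degree_smult_le])
qed

text \<open>
  Homogeneity of degree \<open>d\<close> gives \<open>f(x + t v) = t\<^sup>d f(v + x/t)\<close> for \<open>t \<noteq> 0\<close>, so exchanging point and
  direction reverses the coefficients.  The two leading coefficients on the line through \<open>x\<close> in
  direction \<open>v\<close>, which belong to derivatives of order \<open>d - 1\<close> and \<open>d\<close>, are thereby values at \<open>v\<close>
  of derivatives of order \<open>1\<close> and \<open>0\<close>, where complete log-concavity controls their sign.
\<close>
lemma coeff_line_poly_swap:
  assumes "homogeneous f" "k \<le> total_degree f"
  shows "coeff (line_poly f x v) k = coeff (line_poly f v x) (total_degree f - k)"
proof -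
  define d where "d = total_degree f"
  have deg: "degree (line_poly f v x) \<le> d"
    using degree_line_poly_le[OF assms(1)] by (simp add: d_def)
  define q where "q = (\<Sum>j\<le>d. monom (coeff (line_poly f v x) (d - j)) j)"
  have "poly (line_poly f x v) t = poly q t" if "t \<noteq> 0" for t
  proof -
    have "x + t *\<^sub>R v = t *\<^sub>R (v + inverse t *\<^sub>R x)"
      using that by (simp add: scaleR_add_right)
    then have "poly (line_poly f x v) t = t ^ d * poly (line_poly f v x) (inverse t)"
      using assms by (simp add: poly_line_poly eval_scaleR_homogeneous d_def)
    also have "poly (line_poly f v x) (inverse t)
        = (\<Sum>j\<le>d. coeff (line_poly f v x) j * inverse t ^ j)"
      unfolding poly_altdef using deg
      by (intro sum.mono_neutral_left) (auto simp: coeff_eq_0)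
    also have "t ^ d * \<dots> = (\<Sum>j\<le>d. coeff (line_poly f v x) j * t ^ (d - j))"
      unfolding sum_distrib_left using that
      by (intro sum.cong) (auto simp: power_diff field_simps)
    also have "\<dots> = (\<Sum>j\<le>d. coeff (line_poly f v x) (d - j) * t ^ j)"
      by (rule sum.reindex_bij_witness[of _ "\<lambda>j. d - j" "\<lambda>j. d - j"]) auto
    finally show ?thesis by (simp add: q_def poly_sum poly_monom)
  qed
  \<comment> \<open>The two polynomials agree at infinitely many points, hence are equal.\<close>
  then have "- {0} \<subseteq> {t. poly (line_poly f x v - q) t = 0}" by auto
  moreover have "infinite (- {0::real})"
    by (simp add: infinite_UNIV_char_0 Compl_eq_Diff_UNIV)
  ultimately have "line_poly f x v - q = 0"
    using poly_roots_finite finite_subset by blast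
  then have "line_poly f x v = q" by simp
  then have "coeff (line_poly f x v) k = coeff q k" by simp
  also have "\<dots> = coeff (line_poly f v x) (d - k)"
    using assms by (simp add: q_def coeff_sum d_def)
  finally show "coeff (line_poly f x v) k = coeff (line_poly f v x) (total_degree f - k)"
    by (simp add: d_def)
qed

section \<open>The constant and the cone\<close>

text \<open>
  Uniqueness of the positive root: for two distinct roots \<open>u, t\<close> the divided difference of the
  cubic vanishes; it is the sum of \<open>u\<^sup>2 - u - 2 = 1/u\<close>, \<open>t\<^sup>2 - t - 2 = 1/t\<close>, \<open>u t\<close> and \<open>2\<close>, all
  positive.  The equation for \<open>\<surd>\<alpha>\<close> is the square root of \<open>\<alpha>\<^sup>3 = (\<alpha> + 1)\<^sup>2\<close>.
\<close>
lemma sqrt_alpha: "sqrt alpha > 0" "sqrt alpha ^ 3 = sqrt alpha ^ 2 + 1"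
proof -
  let ?P = "\<lambda>t::real. 0 < t \<and> t ^ 3 - t ^ 2 - 2 * t - 1 = 0"
  have "\<exists>t\<ge>0. t \<le> 3 \<and> t ^ 3 - t ^ 2 - 2 * t - 1 = (0::real)"
    by (rule IVT') (auto intro!: continuous_intros simp: eval_nat_numeral)
  then obtain t :: real where t: "t \<ge> 0" "t ^ 3 - t ^ 2 - 2 * t - 1 = 0" by blast
  with t have "?P t" by (cases "t = 0") auto
  moreover have "u = t" if "?P u" "?P t" for u t
  proof (rule ccontr)
    assume "u \<noteq> t"
    have "(u - t) * (u\<^sup>2 + u * t + t\<^sup>2 - u - t - 2)
        = (u ^ 3 - u ^ 2 - 2 * u - 1) - (t ^ 3 - t ^ 2 - 2 * t - 1)"
      by (simp add: eval_nat_numeral algebra_simps)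
    with that \<open>u \<noteq> t\<close> have eq: "u\<^sup>2 + u * t + t\<^sup>2 - u - t - 2 = 0" by simp
    have "u * (u\<^sup>2 - u - 2) = 1" "t * (t\<^sup>2 - t - 2) = 1"
      using that by (simp_all add: eval_nat_numeral algebra_simps)
    then have "u\<^sup>2 - u - 2 > 0" "t\<^sup>2 - t - 2 > 0" using that
      by (metis zero_less_mult_pos zero_less_one)+
    moreover have "u * t > 0" using that by simp
    ultimately show False using eq by linarith
  qed
  ultimately have ex1: "\<exists>!t. ?P t" by blast
  have a: "0 < alpha" "alpha ^ 3 - alpha ^ 2 - 2 * alpha - 1 = 0"
    using theI'[OF ex1] by (simp_all add: alpha_def)
  then show pos: "sqrt alpha > 0" by simp
  have "(sqrt alpha ^ 3) ^ 2 = (sqrt alpha ^ 2) ^ 3" by (simp only: power_mult[symmetric] mult.commute)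
  also have "\<dots> = alpha ^ 3" using a by simp
  also have "\<dots> = (alpha + 1) ^ 2" using a by (simp add: power2_eq_square algebra_simps)
  finally have "sqrt alpha ^ 3 = alpha + 1"
    using a pos by (subst (asm) power2_eq_iff_nonneg) auto
  then show "sqrt alpha ^ 3 = sqrt alpha ^ 2 + 1" using a by simp
qed

lemma zero_notin_interior_pointed:
  fixes K :: "(real^'n::finite) set"
  assumes "K \<inter> uminus ` K = {0}"
  shows "0 \<notin> interior K"
proof
  assume "0 \<in> interior K"
  then obtain e where e: "e > 0" "cball 0 e \<subseteq> K" by (meson mem_interior_cball)
  obtain u :: "real^'n" where u: "norm u = e" using vector_choose_size[of e] e by auto
  then have "u \<in> K" "- u \<in> K" using e by auto
  then have "u \<in> K \<inter> uminus ` K" by (auto intro: image_eqI[of _ _ "- u"])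
  with assms have "u = 0" by blast
  with u e show False by simp
qed

section \<open>Stability of strictly Lorentzian forms\<close>

theorem theorem4p20:
  fixes K :: "(real^'n::finite) set" and f :: "'n rpoly" and d :: nat
  assumes "proper_convex_cone K"
    and "total_degree f = d" and "d \<ge> 5"
    and "strictly_Lorentzian K f"
    and "\<And>k x v. 1 \<le> k \<Longrightarrow> k \<le> d - 1 \<Longrightarrow> x \<in> interior K \<Longrightarrow> v \<in> interior K \<Longrightarrow>
      (eval ((dir_diff v ^^ k) f) x)\<^sup>2 >
        sqrt alpha * real k / (real k + 1)
          * eval ((dir_diff v ^^ (k - 1)) f) x * eval ((dir_diff v ^^ (k + 1)) f) x"
  shows "hurwitz_stable_over K f"
proof -
  have hom: "homogeneous f" and clc: "strictly_CLC K f"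
    using assms(4) by (auto simp: strictly_Lorentzian_def)
  have nz: "x \<in> K - {0}" if "x \<in> interior K" for x
    using that zero_notin_interior_pointed[of K] assms(1) interior_subset[of K]
    by (auto simp: proper_convex_cone_def)
  have low: "coeff (line_poly f x v) k > 0"
    if "x \<in> interior K" "v \<in> interior K" "k + 2 \<le> d" for x v k
  proof -
    have "strictly_log_concave_at (foldr dir_diff (replicate k v) f) x"
      using clc[unfolded strictly_CLC_def, rule_format, of "replicate k v" x] nz that assms(2)
      by (auto simp: set_replicate_conv_if)
    then have "eval ((dir_diff v ^^ k) f) x > 0"
      by (simp add: strictly_log_concave_at_def foldr_replicate)
    then have "fact k * coeff (line_poly f x v) k > 0" by (simp only: coeff_line_poly)
    then show ?thesis by (simp add: zero_less_mult_iff)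
  qed
  have "hurwitz_stable (line_poly f x v)" if xv: "x \<in> interior K" "v \<in> interior K" for x v
  proof -
    let ?p = "line_poly f x v"
    have pos: "coeff ?p k > 0" if "k \<le> d" for k
    proof (cases "k + 2 \<le> d")
      case True
      with low xv show ?thesis by blast
    next
      case False
      then have "coeff (line_poly f v x) (d - k) > 0" using xv assms(3) by (intro low) auto
      then show ?thesis using coeff_line_poly_swap[OF hom, of k x v] that assms(2) by simp
    qed
    have deg: "degree ?p = d"
      using degree_line_poly_le[OF hom, of x v] pos[of d] assms(2)
      by (intro antisym le_degree) auto
    show ?thesis
    proof (rule hurwitz_stable_if_strongly_log_concave[OF sqrt_alpha])
      fix k assume k: "1 \<le> k" "k < degree ?p"
      then obtain j where j: "k = Suc j" by (cases k) auto
      let ?c = "coeff ?p"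
      have "(fact k * ?c k)\<^sup>2 > sqrt alpha * real k / (real k + 1)
          * (fact (k - 1) * ?c (k - 1)) * (fact (k + 1) * ?c (k + 1))"
        unfolding coeff_line_poly using assms(5)[of k x v] k deg xv by simp
      also have "sqrt alpha * real k / (real k + 1)
          * (fact (k - 1) * ?c (k - 1)) * (fact (k + 1) * ?c (k + 1))
          = (fact k)\<^sup>2 * (sqrt alpha * ?c (k - 1) * ?c (k + 1))"
        unfolding j by (simp add: fact_Suc power2_eq_square divide_simps)
      finally show "sqrt alpha * ?c (k - 1) * ?c (k + 1) < (?c k)\<^sup>2"
        by (simp add: power_mult_distrib)
    qed (use pos deg in auto)
  qed
  then show ?thesis by (simp add: hurwitz_stable_over_def)
qed

end
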